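(* Let $O$ be a partial order on a set $X$ and $P$ a partial order on a set $Y$, where $X\cap Y=\emptyset$ (no finiteness is assumed). Consider: $\mathcal{Q}(O,P)=\{Q \text{ quasiorder on } X\cup Y \mid Q\cap(X\times X)=O,\ Q\cap(Y\times Y)=P,\ Q\cap(Y\times X)=\emptyset\}$, ordered by inclusion; $\mathcal{D}(O,P)$, the set of all maps $f:Y\to\mathcal{D}(O)$ that are isotone from $(Y,P)$ to $(\mathcal{D}(O),\subseteq)$, ordered pointwise; $\mathcal{U}(O,P)$, the set of all maps $g:X\to\mathcal{U}(P)$ that are antitone from $(X,O)$ to $(\mathcal{U}(P),\subseteq)$ (i.e. $x\,O\,x'$ implies $g(x')\subseteq g(x)$), ordered pointwise; $\mathcal{J}(O,P)$, the set of all maps $h:\mathcal{D}(P)\to\mathcal{D}(O)$ preserving arbitrary unions, ordered pointwise; $\mathcal{R}(O,P)=\{R\subseteq X\times Y\mid OR\cup RP\subseteq R\}$, ordered by inclusion; and the tensor product $\mathcal{U}(O)\otimes\mathcal{D}(P)$. Then each of these six ordered sets is a superalgebraic lattice, and all six are isomorphic to one another.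
   Context: For a partial order $O$ on $X$, $\mathcal{D}(O)$ denotes the set of downsets (subsets $D\subseteq X$ with $x\,O\,y\in D\Rightarrow x\in D$) and $\mathcal{U}(O)$ the set of upsets (defined dually), both ordered by inclusion. A quasiorder is a reflexive transitive relation. For relations $R\subseteq X\times Y$, $S\subseteq Y\times Z$, the composite is $RS=\{(x,z)\mid \exists y:\ (x,y)\in R,\ (y,z)\in S\}$. A superalgebraic lattice is a completely distributive algebraic lattice. For complete lattices $C,D$, the tensor product $C\otimes D$ is the complete lattice of all maps from $C$ to the order dual of $D$ that preserve arbitrary joins, ordered pointwise. *)

theory Defs
  imports "HOL-Algebra.Complete_Lattice"
begin

text \<open>
  Ordered sets are \<open>gorder\<close> records with equality as equivalence. Maps out of a set are taken
  extensional, so that a map on a carrier is a unique HOL function.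
\<close>

abbreviation incl_order :: "'a set set \<Rightarrow> 'a set gorder"
  where "incl_order \<A> \<equiv> \<lparr>carrier = \<A>, eq = (=), le = (\<subseteq>)\<rparr>"

abbreviation pointwise_order ::
    "'a set \<Rightarrow> ('b \<Rightarrow> 'b \<Rightarrow> bool) \<Rightarrow> ('a \<Rightarrow> 'b) set \<Rightarrow> ('a \<Rightarrow> 'b) gorder"
  where "pointwise_order X l F \<equiv> \<lparr>carrier = F, eq = (=), le = (\<lambda>f g. \<forall>x\<in>X. l (f x) (g x))\<rparr>"

definition order_isomorphic :: "('a, 'c) gorder_scheme \<Rightarrow> ('b, 'd) gorder_scheme \<Rightarrow> bool"
  where "order_isomorphic L M \<longleftrightarrow> (\<exists>f. bij_betw f (carrier L) (carrier M) \<and> order_emb L M f)"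


definition compact_elements :: "('a, 'c) gorder_scheme \<Rightarrow> 'a set"
  where "compact_elements L =
    {k \<in> carrier L. \<forall>A \<subseteq> carrier L. k \<sqsubseteq>\<^bsub>L\<^esub> \<Squnion>\<^bsub>L\<^esub> A \<longrightarrow>
      (\<exists>F \<subseteq> A. finite F \<and> k \<sqsubseteq>\<^bsub>L\<^esub> \<Squnion>\<^bsub>L\<^esub> F)}"

definition algebraic_lattice :: "('a, 'c) gorder_scheme \<Rightarrow> bool"
  where "algebraic_lattice L \<longleftrightarrow> complete_lattice L \<and>
    (\<forall>x \<in> carrier L. x = \<Squnion>\<^bsub>L\<^esub> {k \<in> compact_elements L. k \<sqsubseteq>\<^bsub>L\<^esub> x})"

text \<open>The choice functions are those of the class \<open>complete_distrib_lattice\<close>.\<close>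

definition completely_distributive :: "('a, 'c) gorder_scheme \<Rightarrow> bool"
  where "completely_distributive L \<longleftrightarrow> complete_lattice L \<and>
    (\<forall>\<A> \<subseteq> Pow (carrier L).
      \<Sqinter>\<^bsub>L\<^esub> ((\<lambda>A. \<Squnion>\<^bsub>L\<^esub> A) ` \<A>) = \<Squnion>\<^bsub>L\<^esub> {\<Sqinter>\<^bsub>L\<^esub> (f ` \<A>) |f. \<forall>A\<in>\<A>. f A \<in> A})"

definition superalgebraic_lattice :: "('a, 'c) gorder_scheme \<Rightarrow> bool"
  where "superalgebraic_lattice L \<longleftrightarrow> completely_distributive L \<and> algebraic_lattice L"


definition downsets :: "'a set \<Rightarrow> 'a rel \<Rightarrow> 'a set set"
  where "downsets X r = {D. D \<subseteq> X \<and> (\<forall>x y. (x, y) \<in> r \<and> y \<in> D \<longrightarrow> x \<in> D)}"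

definition upsets :: "'a set \<Rightarrow> 'a rel \<Rightarrow> 'a set set"
  where "upsets X r = {U. U \<subseteq> X \<and> (\<forall>x y. (x, y) \<in> r \<and> x \<in> U \<longrightarrow> y \<in> U)}"

text \<open>
  Both join preservation and the pointwise order refer to the codomain \<open>inv_gorder D\<close>:
  \<open>f\<close> is below \<open>g\<close> iff \<open>g c\<close> is below \<open>f c\<close> in \<open>D\<close> for all \<open>c\<close>.
\<close>

definition tensor_product ::
    "('a, 'c) gorder_scheme \<Rightarrow> ('b, 'd) gorder_scheme \<Rightarrow> ('a \<Rightarrow> 'b) gorder"
  where "tensor_product C D = pointwise_order (carrier C) (le (inv_gorder D))
    {f \<in> carrier C \<rightarrow>\<^sub>E carrier (inv_gorder D). sup_pres C (inv_gorder D) f}"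


text \<open>In the following, \<open>r\<close> is the order on \<open>X\<close> and \<open>s\<close> the order on \<open>Y\<close>.\<close>

definition quasiorder_extensions :: "'a set \<Rightarrow> 'a rel \<Rightarrow> 'a set \<Rightarrow> 'a rel \<Rightarrow> 'a rel gorder"
  where "quasiorder_extensions X r Y s = incl_order
    {Q. preorder_on (X \<union> Y) Q \<and> Q \<inter> (X \<times> X) = r \<and> Q \<inter> (Y \<times> Y) = s \<and> Q \<inter> (Y \<times> X) = {}}"

definition isotone_downset_maps ::
    "'a set \<Rightarrow> 'a rel \<Rightarrow> 'a set \<Rightarrow> 'a rel \<Rightarrow> ('a \<Rightarrow> 'a set) gorder"
  where "isotone_downset_maps X r Y s = pointwise_order Y (\<subseteq>)
    {f \<in> Y \<rightarrow>\<^sub>E downsets X r. monotone_on Y (\<lambda>y y'. (y, y') \<in> s) (\<subseteq>) f}"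

definition antitone_upset_maps ::
    "'a set \<Rightarrow> 'a rel \<Rightarrow> 'a set \<Rightarrow> 'a rel \<Rightarrow> ('a \<Rightarrow> 'a set) gorder"
  where "antitone_upset_maps X r Y s = pointwise_order X (\<subseteq>)
    {g \<in> X \<rightarrow>\<^sub>E upsets Y s. monotone_on X (\<lambda>x x'. (x, x') \<in> r) (\<supseteq>) g}"

definition union_preserving_maps ::
    "'a set \<Rightarrow> 'a rel \<Rightarrow> 'a set \<Rightarrow> 'a rel \<Rightarrow> ('a set \<Rightarrow> 'a set) gorder"
  where "union_preserving_maps X r Y s = pointwise_order (downsets Y s) (\<subseteq>)
    {h \<in> downsets Y s \<rightarrow>\<^sub>E downsets X r. \<forall>\<A> \<subseteq> downsets Y s. h (\<Union>\<A>) = \<Union>(h ` \<A>)}"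

definition stable_relations :: "'a set \<Rightarrow> 'a rel \<Rightarrow> 'a set \<Rightarrow> 'a rel \<Rightarrow> 'a rel gorder"
  where "stable_relations X r Y s = incl_order {R. R \<subseteq> X \<times> Y \<and> r O R \<union> R O s \<subseteq> R}"

definition upset_downset_tensor ::
    "'a set \<Rightarrow> 'a rel \<Rightarrow> 'a set \<Rightarrow> 'a rel \<Rightarrow> ('a set \<Rightarrow> 'a set) gorder"
  where "upset_downset_tensor X r Y s =
    tensor_product (incl_order (upsets X r)) (incl_order (downsets Y s))"

end

theory Submission
  imports Defs
begin

text \<open>
  The hub is the lattice of stable relations: it is a family of subsets of \<open>X \<times> Y\<close> closed under
  arbitrary unions and intersections. In such a family the least member containing a given point is
  completely join-prime, and every member is a union of such elements; complete distributivity is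
  inherited from the power set. A stable relation \<open>R\<close> corresponds to the quasiorder \<open>r \<union> s \<union> R\<close>,
  to its column and row maps, to \<open>D \<mapsto> R\<inverse> `` D\<close>, and to \<open>U \<mapsto> Y - R `` U\<close>. The last two maps
  are surjective because every downset (upset) is the union of the principal ones it contains.
\<close>

section \<open>Order isomorphisms\<close>

lemma order_isomorphic_sym:
  assumes "order_isomorphic L M"
  shows "order_isomorphic M L"
proof -
  from assms obtain f where f: "bij_betw f (carrier L) (carrier M)" and emb: "order_emb L M f"
    unfolding order_isomorphic_def by blast
  let ?g = "inv_into (carrier L) f"
  have g: "bij_betw ?g (carrier M) (carrier L)"
    by (rule bij_betw_inv_into [OF f])
  have fg: "f (?g y) = y" if "y \<in> carrier M" for y
    using f that by (rule bij_betw_inv_into_right)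
  have mem: "?g y \<in> carrier L" if "y \<in> carrier M" for y
    using g that by (rule bij_betw_apply)
  have "?g x \<sqsubseteq>\<^bsub>L\<^esub> ?g y \<longleftrightarrow> x \<sqsubseteq>\<^bsub>M\<^esub> y" if "x \<in> carrier M" "y \<in> carrier M" for x y
    using emb mem [OF that(1)] mem [OF that(2)] fg [OF that(1)] fg [OF that(2)]
    unfolding order_emb_def by metis
  with g emb show ?thesis
    unfolding order_isomorphic_def order_emb_def by blast
qed

lemma order_isomorphic_trans:
  assumes "order_isomorphic L M" and "order_isomorphic M N"
  shows "order_isomorphic L N"
proof -
  from assms obtain f g
    where f: "bij_betw f (carrier L) (carrier M)" "order_emb L M f"
      and g: "bij_betw g (carrier M) (carrier N)" "order_emb M N g"
    unfolding order_isomorphic_def by blast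
  have "f x \<in> carrier M" if "x \<in> carrier L" for x
    using f(1) that by (rule bij_betw_apply)
  then have "order_emb L N (g \<circ> f)"
    using f(2) g(2) unfolding order_emb_def by simp
  with bij_betw_trans [OF f(1) g(1)] show ?thesis
    unfolding order_isomorphic_def by blast
qed

lemma partial_order_incl_order: "partial_order (incl_order \<A>)"
  by unfold_locales auto

text \<open>Extensionality is what gives antisymmetry: the pointwise relation sees the values on
  \<open>A\<close> only, so two maps below each other agree there and are \<open>undefined\<close>
  elsewhere.\<close>

lemma partial_order_pointwise_order:
  assumes "F \<subseteq> extensional A"
    and "\<And>x. l x x"
    and "\<And>x y. l x y \<Longrightarrow> l y x \<Longrightarrow> x = y"
    and "\<And>x y z. l x y \<Longrightarrow> l y z \<Longrightarrow> l x z"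
  shows "partial_order (pointwise_order A l F)"
proof unfold_locales
  fix f g assume "f \<sqsubseteq>\<^bsub>pointwise_order A l F\<^esub> g" "g \<sqsubseteq>\<^bsub>pointwise_order A l F\<^esub> f"
    "f \<in> carrier (pointwise_order A l F)" "g \<in> carrier (pointwise_order A l F)"
  then have "f = g"
    using assms(1,3) by (intro extensionalityI [of f A g]) auto
  then show "f .=\<^bsub>pointwise_order A l F\<^esub> g" by simp
qed (auto intro: assms(2) dest: assms(4))

text \<open>Injectivity comes from reflecting the order together with antisymmetry, so each
  isomorphism below reduces to membership, order equivalence and a preimage for every
  element.\<close>

lemma order_isomorphicI:
  assumes L: "partial_order L" and M: "partial_order M"
    and mem: "\<And>x. x \<in> carrier L \<Longrightarrow> f x \<in> carrier M"
    and le: "\<And>x y. x \<in> carrier L \<Longrightarrow> y \<in> carrier L \<Longrightarrow> f x \<sqsubseteq>\<^bsub>M\<^esub> f y \<longleftrightarrow> x \<sqsubseteq>\<^bsub>L\<^esub> y"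
    and surj: "\<And>z. z \<in> carrier M \<Longrightarrow> \<exists>x\<in>carrier L. f x = z"
  shows "order_isomorphic L M"
proof -
  interpret L: partial_order L by (rule L)
  interpret M: partial_order M by (rule M)
  have "inj_on f (carrier L)"
    by (rule inj_onI) (metis L.le_antisym M.le_refl le mem)
  moreover have "f ` carrier L = carrier M"
    using mem surj by blast
  ultimately have "bij_betw f (carrier L) (carrier M)"
    by (simp add: bij_betw_def)
  moreover have "order_emb L M f"
    unfolding order_emb_def
    using L.weak_partial_order_axioms M.weak_partial_order_axioms le by blast
  ultimately show ?thesis
    unfolding order_isomorphic_def by blast
qed

section \<open>Complete rings of sets\<close>

text \<open>The representation \<open>\<phi>\<close> is a parameter, not the identity, so that
  ordered sets of maps can be instances as well. Intersecting with \<open>Z\<close> makes the meet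
  of the empty family \<open>Z\<close> instead of \<open>UNIV\<close>.\<close>

locale complete_ring_of_sets = partial_order L for L (structure) +
  fixes \<phi> :: "'a \<Rightarrow> 'b set" and Z :: "'b set"
  assumes le_iff: "x \<in> carrier L \<Longrightarrow> y \<in> carrier L \<Longrightarrow> x \<sqsubseteq> y \<longleftrightarrow> \<phi> x \<subseteq> \<phi> y"
    and subset: "x \<in> carrier L \<Longrightarrow> \<phi> x \<subseteq> Z"
    and Union_exists: "A \<subseteq> carrier L \<Longrightarrow> \<exists>s\<in>carrier L. \<phi> s = \<Union>(\<phi> ` A)"
    and Inter_exists: "A \<subseteq> carrier L \<Longrightarrow> \<exists>i\<in>carrier L. \<phi> i = Z \<inter> \<Inter>(\<phi> ` A)"
begin

lemma is_lubI:
  assumes "A \<subseteq> carrier L" "s \<in> carrier L" "\<phi> s = \<Union>(\<phi> ` A)"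
  shows "is_lub L s A"
proof (rule least_UpperI)
  fix y assume "y \<in> Upper L A"
  with assms(1) have y: "y \<in> carrier L" "\<forall>x\<in>A. x \<sqsubseteq> y"
    unfolding Upper_def by auto
  with assms show "s \<sqsubseteq> y" by (auto simp: le_iff subset_iff)
qed (use assms in \<open>auto simp: le_iff subset_iff\<close>)

lemma is_glbI:
  assumes "A \<subseteq> carrier L" "i \<in> carrier L" "\<phi> i = Z \<inter> \<Inter>(\<phi> ` A)"
  shows "is_glb L i A"
proof (rule greatest_LowerI)
  fix y assume "y \<in> Lower L A"
  with assms(1) have y: "y \<in> carrier L" "\<forall>x\<in>A. y \<sqsubseteq> x"
    unfolding Lower_def by auto
  with assms subset [of y] show "y \<sqsubseteq> i" by (auto simp: le_iff subset_iff)
qed (use assms in \<open>auto simp: le_iff subset_iff\<close>)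

sublocale complete_lattice L
proof unfold_locales
  show "\<exists>s. is_lub L s A" if "A \<subseteq> carrier L" for A
    using that Union_exists is_lubI by blast
  show "\<exists>i. is_glb L i A" if "A \<subseteq> carrier L" for A
    using that Inter_exists is_glbI by blast
qed

text \<open>The element representing the union is a least upper bound, and least upper bounds are
  unique, so it is the one that the choice operator picks.\<close>

lemma repr_sup: "\<phi> (\<Squnion>A) = \<Union>(\<phi> ` A)" if A: "A \<subseteq> carrier L"
  using Union_exists [OF A] is_lubI [OF A] least_unique [OF sup_lub [OF A]] by metis

lemma repr_inf: "\<phi> (\<Sqinter>A) = Z \<inter> \<Inter>(\<phi> ` A)" if A: "A \<subseteq> carrier L"
  using Inter_exists [OF A] is_glbI [OF A] greatest_unique [OF inf_glb [OF A]] by metis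

lemma eqI: "x \<in> carrier L \<Longrightarrow> y \<in> carrier L \<Longrightarrow> \<phi> x = \<phi> y \<Longrightarrow> x = y"
  by (simp add: le_antisym le_iff)

text \<open>Since \<open>\<phi>\<close> turns joins into unions and meets into intersections within
  \<open>Z\<close>, the law becomes the one for the power set of \<open>Z\<close>; injectivity of
  \<open>\<phi>\<close> pulls it back.\<close>

lemma completely_distributive: "completely_distributive L"
  unfolding completely_distributive_def
proof (intro conjI allI impI)
  fix \<A> assume \<A>: "\<A> \<subseteq> Pow (carrier L)"
  let ?C = "{f. \<forall>A\<in>\<A>. f A \<in> A}"
  let ?S = "{\<Sqinter>(f ` \<A>) |f. \<forall>A\<in>\<A>. f A \<in> A}"
  have sups: "(\<lambda>A. \<Squnion>A) ` \<A> \<subseteq> carrier L"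
    using \<A> by auto
  have choice: "f ` \<A> \<subseteq> carrier L" if "f \<in> ?C" for f
    using \<A> that by auto
  then have S: "?S \<subseteq> carrier L"
    by auto
  have "\<phi> (\<Sqinter>((\<lambda>A. \<Squnion>A) ` \<A>)) = Z \<inter> (\<Inter>A\<in>\<A>. \<Union>(\<phi> ` A))"
    using repr_inf [OF sups] repr_sup \<A> by (simp add: image_image subset_iff)
  also have "\<dots> = (\<Union>f\<in>?C. Z \<inter> (\<Inter>A\<in>\<A>. \<phi> (f A)))"
  proof
    show "Z \<inter> (\<Inter>A\<in>\<A>. \<Union>(\<phi> ` A)) \<subseteq> (\<Union>f\<in>?C. Z \<inter> (\<Inter>A\<in>\<A>. \<phi> (f A)))"
    proof
      fix z assume z: "z \<in> Z \<inter> (\<Inter>A\<in>\<A>. \<Union>(\<phi> ` A))"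
      \<comment> \<open>The choice function depends on the point \<open>z\<close>: from each
        \<open>A\<close> it selects a member whose set contains \<open>z\<close>.\<close>
      then have "\<forall>A\<in>\<A>. \<exists>a. a \<in> A \<and> z \<in> \<phi> a" by auto
      then obtain f where "\<forall>A\<in>\<A>. f A \<in> A \<and> z \<in> \<phi> (f A)" by metis
      with z show "z \<in> (\<Union>f\<in>?C. Z \<inter> (\<Inter>A\<in>\<A>. \<phi> (f A)))" by auto
    qed
  qed auto
  also have "\<dots> = (\<Union>f\<in>?C. \<phi> (\<Sqinter>(f ` \<A>)))"
    using repr_inf [OF choice] by (intro SUP_cong) (simp_all add: image_image)
  also have "\<dots> = \<Union>(\<phi> ` ?S)"
    by blast
  also have "\<dots> = \<phi> (\<Squnion>?S)"
    by (rule repr_sup [OF S, symmetric])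
  finally show "\<Sqinter>((\<lambda>A. \<Squnion>A) ` \<A>) = \<Squnion>?S"
    by (intro eqI inf_closed sup_closed sups S)
qed (rule complete_lattice_axioms)

text \<open>The meet still contains \<open>z\<close>, so it is the least element that does. If it
  lies below a join, then \<open>z\<close> lies in some single member \<open>a\<close>, and
  leastness puts the meet below \<open>a\<close>: a one-element subfamily suffices.\<close>

lemma least_member_compact:
  assumes "z \<in> Z"
  shows "\<Sqinter>{a \<in> carrier L. z \<in> \<phi> a} \<in> compact_elements L"
    (is "?k \<in> _")
  unfolding compact_elements_def
proof (intro CollectI conjI allI impI)
  show k: "?k \<in> carrier L"
    by (rule inf_closed) auto
  have z: "z \<in> \<phi> ?k"
    using assms repr_inf [of "{a \<in> carrier L. z \<in> \<phi> a}"] by auto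
  fix A assume A: "A \<subseteq> carrier L" "?k \<sqsubseteq> \<Squnion>A"
  then have "\<phi> ?k \<subseteq> \<Union>(\<phi> ` A)"
    using le_iff [OF k sup_closed] repr_sup by simp
  with z obtain a where a: "a \<in> A" "z \<in> \<phi> a" by auto
  then have "?k \<sqsubseteq> a"
    using A(1) by (intro inf_lower) auto
  moreover have "\<Squnion>{a} = a"
    using a A(1) by auto
  ultimately show "\<exists>F\<subseteq>A. finite F \<and> ?k \<sqsubseteq> \<Squnion>F"
    using a(1) by (intro exI [of _ "{a}"]) simp
qed

text \<open>Each point \<open>z\<close> of \<open>\<phi> x\<close> is covered by the least element
  containing \<open>z\<close>, which is compact and lies below \<open>x\<close>.\<close>

lemma algebraic: "algebraic_lattice L"
  unfolding algebraic_lattice_def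
proof (intro conjI ballI)
  fix x assume x: "x \<in> carrier L"
  let ?K = "{k \<in> compact_elements L. k \<sqsubseteq> x}"
  have K: "?K \<subseteq> carrier L"
    by (auto simp: compact_elements_def)
  show "x = \<Squnion>?K"
  proof (rule le_antisym)
    have "\<phi> x \<subseteq> \<Union>(\<phi> ` ?K)"
    proof
      fix z assume z: "z \<in> \<phi> x"
      let ?k = "\<Sqinter>{a \<in> carrier L. z \<in> \<phi> a}"
      have "z \<in> Z" using z subset [OF x] by auto
      then have "z \<in> \<phi> ?k" "?k \<in> compact_elements L"
        using repr_inf [of "{a \<in> carrier L. z \<in> \<phi> a}"] least_member_compact by auto
      moreover have "?k \<sqsubseteq> x"
        using x z by (intro inf_lower) auto
      ultimately show "z \<in> \<Union>(\<phi> ` ?K)" by blast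
    qed
    then show "x \<sqsubseteq> \<Squnion>?K"
      using le_iff [OF x sup_closed [OF K]] repr_sup [OF K] by simp
    show "\<Squnion>?K \<sqsubseteq> x"
      using K x by (intro sup_least) auto
  qed (use x sup_closed [OF K] in auto)
qed (rule complete_lattice_axioms)

lemma superalgebraic: "superalgebraic_lattice L"
  by (simp add: superalgebraic_lattice_def completely_distributive algebraic)

text \<open>Needed for the tensor product, where \<open>sup_pres\<close> also asks for completeness
  of the reversed codomain.\<close>

lemma dual_complete_lattice: "complete_lattice (inv_gorder L)"
proof -
  interpret dual: partial_order "inv_gorder L" by (rule dual_order)
  show ?thesis
    by unfold_locales (use inf_exists sup_exists in auto)
qed

end

section \<open>Instances of complete rings of sets and their transfer along isomorphisms\<close>

lemma complete_ring_of_sets_incl_order: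
  assumes "\<And>S. S \<in> \<S> \<Longrightarrow> S \<subseteq> Z"
    and "\<And>\<A>. \<A> \<subseteq> \<S> \<Longrightarrow> \<Union>\<A> \<in> \<S>"
    and "\<And>\<A>. \<A> \<subseteq> \<S> \<Longrightarrow> Z \<inter> \<Inter>\<A> \<in> \<S>"
  shows "complete_ring_of_sets (incl_order \<S>) (\<lambda>S. S) Z"
  using partial_order_incl_order assms
  by (auto simp: complete_ring_of_sets_def complete_ring_of_sets_axioms_def)

text \<open>Composing \<open>\<phi>\<close> with the isomorphism represents \<open>M\<close> by the
  same sets. Thus superalgebraicity passes to isomorphic copies without tracing compact elements or
  choice functions through the isomorphism.\<close>

lemma complete_ring_of_sets_transfer:
  assumes "complete_ring_of_sets L \<phi> Z" and "partial_order M" and "order_isomorphic M L"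
  shows "\<exists>\<psi>. complete_ring_of_sets M \<psi> Z"
proof -
  note L_axioms = complete_ring_of_sets.axioms(2) [OF assms(1),
      unfolded complete_ring_of_sets_axioms_def]
  from assms(3) obtain f where f: "bij_betw f (carrier M) (carrier L)"
    and emb: "\<forall>x\<in>carrier M. \<forall>y\<in>carrier M. f x \<sqsubseteq>\<^bsub>L\<^esub> f y \<longleftrightarrow> x \<sqsubseteq>\<^bsub>M\<^esub> y"
    unfolding order_isomorphic_def order_emb_def by blast
  have mem: "f x \<in> carrier L" if "x \<in> carrier M" for x
    using f that by (rule bij_betw_apply)
  then have sub: "f ` A \<subseteq> carrier L" if "A \<subseteq> carrier M" for A
    using that by auto
  have surj: "\<exists>x\<in>carrier M. f x = z" if "z \<in> carrier L" for z
    using that unfolding bij_betw_imp_surj_on [OF f, symmetric] by auto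
  have "complete_ring_of_sets M (\<lambda>x. \<phi> (f x)) Z"
  proof (intro complete_ring_of_sets.intro complete_ring_of_sets_axioms.intro assms(2))
    show "x \<sqsubseteq>\<^bsub>M\<^esub> y \<longleftrightarrow> \<phi> (f x) \<subseteq> \<phi> (f y)" if "x \<in> carrier M" "y \<in> carrier M" for x y
      using that emb L_axioms mem by simp
    show "\<phi> (f x) \<subseteq> Z" if "x \<in> carrier M" for x
      using that L_axioms mem by simp
    show "\<exists>s\<in>carrier M. \<phi> (f s) = (\<Union>x\<in>A. \<phi> (f x))" if A: "A \<subseteq> carrier M" for A
    proof -
      obtain t where "t \<in> carrier L" "\<phi> t = \<Union>(\<phi> ` f ` A)"
        using L_axioms sub [OF A] by meson
      with surj [of t] show ?thesis by (auto simp: image_image)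
    qed
    show "\<exists>i\<in>carrier M. \<phi> (f i) = Z \<inter> (\<Inter>x\<in>A. \<phi> (f x))" if A: "A \<subseteq> carrier M" for A
    proof -
      obtain t where "t \<in> carrier L" "\<phi> t = Z \<inter> \<Inter>(\<phi> ` f ` A)"
        using L_axioms sub [OF A] by meson
      with surj [of t] show ?thesis by (auto simp: image_image)
    qed
  qed
  then show ?thesis by blast
qed

lemma complete_ring_of_sets_downsets:
  assumes "r \<subseteq> X \<times> X"
  shows "complete_ring_of_sets (incl_order (downsets X r)) (\<lambda>D. D) X"
  unfolding downsets_def
  by (rule complete_ring_of_sets_incl_order) (use assms in blast)+

lemma complete_ring_of_sets_upsets:
  assumes "r \<subseteq> X \<times> X"
  shows "complete_ring_of_sets (incl_order (upsets X r)) (\<lambda>U. U) X"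
  unfolding upsets_def
  by (rule complete_ring_of_sets_incl_order) (use assms in blast)+

text \<open>Joins in the reversed codomain are meets of downsets, hence intersections within
  \<open>Y\<close>. The factor \<open>Y\<close> handles the empty family: the empty upset goes to
  \<open>Y\<close>, the bottom of the reversed order.\<close>

lemma sup_pres_upsets_downsets_iff:
  assumes r: "r \<subseteq> X \<times> X" and s: "s \<subseteq> Y \<times> Y"
    and f: "f \<in> upsets X r \<rightarrow> downsets Y s"
  shows "sup_pres (incl_order (upsets X r)) (inv_gorder (incl_order (downsets Y s))) f \<longleftrightarrow>
    (\<forall>\<A>\<subseteq>upsets X r. f (\<Union>\<A>) = Y \<inter> \<Inter>(f ` \<A>))"
proof -
  interpret U: complete_ring_of_sets "incl_order (upsets X r)" "\<lambda>U. U" X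
    by (rule complete_ring_of_sets_upsets [OF r])
  interpret D: complete_ring_of_sets "incl_order (downsets Y s)" "\<lambda>D. D" Y
    by (rule complete_ring_of_sets_downsets [OF s])
  have "f (\<Squnion>\<^bsub>incl_order (upsets X r)\<^esub> \<A>) = \<Squnion>\<^bsub>inv_gorder (incl_order (downsets Y s))\<^esub> (f ` \<A>)
      \<longleftrightarrow> f (\<Union>\<A>) = Y \<inter> \<Inter>(f ` \<A>)" if "\<A> \<subseteq> upsets X r" for \<A>
  proof -
    have "f ` \<A> \<subseteq> downsets Y s" using f that by auto
    with that show ?thesis
      unfolding sup_dual using U.repr_sup [of \<A>] D.repr_inf [of "f ` \<A>"] by simp
  qed
  then show ?thesis
    unfolding sup_pres_def
    using U.complete_lattice_axioms D.dual_complete_lattice by auto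
qed

section \<open>Principal downsets and upsets\<close>

text \<open>For \<open>y\<close> outside \<open>Y\<close> the set is empty and still a downset, so
  later uses can let \<open>y\<close> range over the whole type.\<close>

lemma principal_downset:
  assumes "partial_order_on Y s"
  shows "s\<inverse> `` {y} \<in> downsets Y s"
  using partial_order_onD(2,4) [OF assms] by (auto simp: downsets_def dest: transD)

lemma principal_upset:
  assumes "partial_order_on X r"
  shows "r `` {x} \<in> upsets X r"
  using partial_order_onD(2,4) [OF assms] by (auto simp: upsets_def dest: transD)

text \<open>Reflexivity gives one inclusion, downward closure the other. A union-preserving map is
  therefore determined by its values on principal downsets.\<close>

lemma downset_eq_Union_principal:
  assumes "partial_order_on Y s" "D \<in> downsets Y s"
  shows "D = \<Union>((\<lambda>y. s\<inverse> `` {y}) ` D)"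
  using partial_order_onD(1) [OF assms(1)] assms(2) by (auto simp: downsets_def refl_on_def)

lemma upset_eq_Union_principal:
  assumes "partial_order_on X r" "U \<in> upsets X r"
  shows "U = \<Union>((\<lambda>x. r `` {x}) ` U)"
  using partial_order_onD(1) [OF assms(1)] assms(2) by (auto simp: upsets_def refl_on_def)

section \<open>Stable relations\<close>

text \<open>In this form the stable relations are visibly the downsets of the product of
  \<open>X\<close> with the order dual of \<open>Y\<close>, which is why they are closed under
  unions and intersections.\<close>

lemma stable_relations_iff:
  "R \<in> carrier (stable_relations X r Y s) \<longleftrightarrow> R \<subseteq> X \<times> Y \<and>
    (\<forall>x x' y. (x, x') \<in> r \<longrightarrow> (x', y) \<in> R \<longrightarrow> (x, y) \<in> R) \<and>
    (\<forall>x y y'. (x, y) \<in> R \<longrightarrow> (y, y') \<in> s \<longrightarrow> (x, y') \<in> R)"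
  unfolding stable_relations_def by fastforce

lemma complete_ring_of_sets_stable_relations:
  "complete_ring_of_sets (stable_relations X r Y s) (\<lambda>R. R) (X \<times> Y)"
  if r: "r \<subseteq> X \<times> X" and s: "s \<subseteq> Y \<times> Y"
proof -
  let ?\<S> = "carrier (stable_relations X r Y s)"
  have "complete_ring_of_sets (incl_order ?\<S>) (\<lambda>R. R) (X \<times> Y)"
  proof (rule complete_ring_of_sets_incl_order)
    show "R \<subseteq> X \<times> Y" if "R \<in> ?\<S>" for R
      using that by (simp add: stable_relations_iff)
    show "\<Union>\<A> \<in> ?\<S>" if "\<A> \<subseteq> ?\<S>" for \<A>
      using that unfolding stable_relations_iff subset_eq by blast
    \<comment> \<open>The bounds on \<open>r\<close> and \<open>s\<close> keep both closure steps
      inside \<open>X \<times> Y\<close> even when \<open>\<A>\<close> is empty.\<close>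
    show "X \<times> Y \<inter> \<Inter>\<A> \<in> ?\<S>" if "\<A> \<subseteq> ?\<S>" for \<A>
    proof -
      have "\<forall>R\<in>\<A>. R \<in> ?\<S>" using that by blast
      with r s show ?thesis unfolding stable_relations_iff by blast
    qed
  qed
  then show ?thesis by (simp add: stable_relations_def)
qed

lemma partial_order_stable_relations: "partial_order (stable_relations X r Y s)"
  unfolding stable_relations_def by (rule partial_order_incl_order)

lemma partial_order_quasiorder_extensions: "partial_order (quasiorder_extensions X r Y s)"
  unfolding quasiorder_extensions_def by (rule partial_order_incl_order)

lemma partial_order_isotone_downset_maps: "partial_order (isotone_downset_maps X r Y s)"
  unfolding isotone_downset_maps_def
  by (rule partial_order_pointwise_order) (auto simp: PiE_def)

lemma partial_order_antitone_upset_maps: "partial_order (antitone_upset_maps X r Y s)"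
  unfolding antitone_upset_maps_def
  by (rule partial_order_pointwise_order) (auto simp: PiE_def)

lemma partial_order_union_preserving_maps: "partial_order (union_preserving_maps X r Y s)"
  unfolding union_preserving_maps_def
  by (rule partial_order_pointwise_order) (auto simp: PiE_def)

lemma partial_order_upset_downset_tensor: "partial_order (upset_downset_tensor X r Y s)"
  unfolding upset_downset_tensor_def tensor_product_def
  by (rule partial_order_pointwise_order) (auto simp: PiE_def)

section \<open>Isomorphisms from the stable relations to the other five ordered sets\<close>

locale disjoint_orders =
  fixes X Y :: "'a set" and r s :: "'a rel"
  assumes r: "partial_order_on X r" and s: "partial_order_on Y s" and disjoint: "X \<inter> Y = {}"
begin

lemmas r_props = partial_order_onD [OF r] and s_props = partial_order_onD [OF s]

text \<open>By disjointness a quasiorder on \<open>X \<union> Y\<close> splits into four blocks,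
  three of which are prescribed. Only the block in \<open>X \<times> Y\<close> is free, and
  transitivity across blocks amounts to its stability.\<close>

lemma stable_iso_quasiorder_extensions:
  "order_isomorphic (stable_relations X r Y s) (quasiorder_extensions X r Y s)"
proof (rule order_isomorphicI [where f = "\<lambda>R. r \<union> s \<union> R"])
  fix R assume R: "R \<in> carrier (stable_relations X r Y s)"
  have "trans (r \<union> s \<union> R)"
  proof (rule transI)
    \<comment> \<open>The only mixed composites that can occur are \<open>r\<close> followed by
      \<open>R\<close> and \<open>R\<close> followed by \<open>s\<close>; every other mixture would
      put \<open>b\<close> into both \<open>X\<close> and \<open>Y\<close>.\<close>
    fix a b c assume "(a, b) \<in> r \<union> s \<union> R" "(b, c) \<in> r \<union> s \<union> R"
    with R disjoint r_props(4) s_props(4) transD [OF r_props(2), of a b c]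
      transD [OF s_props(2), of a b c]
    show "(a, c) \<in> r \<union> s \<union> R"
      unfolding stable_relations_iff by blast
  qed
  moreover have "r \<union> s \<union> R \<subseteq> (X \<union> Y) \<times> (X \<union> Y)"
    using R r_props(4) s_props(4) unfolding stable_relations_iff by blast
  moreover have "refl_on (X \<union> Y) (r \<union> s \<union> R)"
    using r_props(1) s_props(1) by (auto simp: refl_on_def)
  moreover have "(r \<union> s \<union> R) \<inter> (X \<times> X) = r" "(r \<union> s \<union> R) \<inter> (Y \<times> Y) = s"
    "(r \<union> s \<union> R) \<inter> (Y \<times> X) = {}"
    using R disjoint r_props(4) s_props(4) unfolding stable_relations_iff by blast+
  ultimately show "r \<union> s \<union> R \<in> carrier (quasiorder_extensions X r Y s)"
    by (simp add: quasiorder_extensions_def preorder_on_def)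
next
  fix R R' assume R: "R \<in> carrier (stable_relations X r Y s)"
    "R' \<in> carrier (stable_relations X r Y s)"
  have "r \<union> s \<union> R \<subseteq> r \<union> s \<union> R' \<longleftrightarrow> R \<subseteq> R'"
    using R disjoint r_props(4) s_props(4) unfolding stable_relations_iff by blast
  then show "r \<union> s \<union> R \<sqsubseteq>\<^bsub>quasiorder_extensions X r Y s\<^esub> r \<union> s \<union> R' \<longleftrightarrow>
      R \<sqsubseteq>\<^bsub>stable_relations X r Y s\<^esub> R'"
    by (simp add: quasiorder_extensions_def stable_relations_def)
next
  fix Q assume "Q \<in> carrier (quasiorder_extensions X r Y s)"
  then have Q: "Q \<subseteq> (X \<union> Y) \<times> (X \<union> Y)" "trans Q" "Q \<inter> (X \<times> X) = r" "Q \<inter> (Y \<times> Y) = s"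
    "Q \<inter> (Y \<times> X) = {}"
    by (auto simp: quasiorder_extensions_def preorder_on_def)
  have "r \<subseteq> Q" "s \<subseteq> Q" using Q by auto
  then have "Q \<inter> (X \<times> Y) \<in> carrier (stable_relations X r Y s)"
    using r_props(4) s_props(4) unfolding stable_relations_iff
    by (blast intro: transD [OF Q(2)])
  moreover have "r \<union> s \<union> Q \<inter> (X \<times> Y) = Q"
    using Q by blast
  ultimately show "\<exists>R\<in>carrier (stable_relations X r Y s). r \<union> s \<union> R = Q"
    by blast
qed (rule partial_order_stable_relations partial_order_quasiorder_extensions)+

text \<open>Closure under \<open>r\<close> makes every column a downset, and closure under
  \<open>s\<close> makes the columns grow with \<open>y\<close>; conversely, the columns reassemble
  the relation.\<close>

lemma stable_iso_isotone_downset_maps: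
  "order_isomorphic (stable_relations X r Y s) (isotone_downset_maps X r Y s)"
proof (rule order_isomorphicI [where f = "\<lambda>R. \<lambda>y\<in>Y. R\<inverse> `` {y}"])
  fix R assume R: "R \<in> carrier (stable_relations X r Y s)"
  then show "(\<lambda>y\<in>Y. R\<inverse> `` {y}) \<in> carrier (isotone_downset_maps X r Y s)"
    unfolding stable_relations_iff isotone_downset_maps_def
    by (auto simp: downsets_def monotone_on_def)
next
  fix R R' assume "R \<in> carrier (stable_relations X r Y s)"
    "R' \<in> carrier (stable_relations X r Y s)"
  then have "(\<forall>y\<in>Y. R\<inverse> `` {y} \<subseteq> R'\<inverse> `` {y}) \<longleftrightarrow> R \<subseteq> R'"
    unfolding stable_relations_iff by blast
  then show "(\<lambda>y\<in>Y. R\<inverse> `` {y}) \<sqsubseteq>\<^bsub>isotone_downset_maps X r Y s\<^esub> (\<lambda>y\<in>Y. R'\<inverse> `` {y}) \<longleftrightarrow>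
      R \<sqsubseteq>\<^bsub>stable_relations X r Y s\<^esub> R'"
    by (simp add: isotone_downset_maps_def stable_relations_def)
next
  fix f assume "f \<in> carrier (isotone_downset_maps X r Y s)"
  then have f: "f \<in> Y \<rightarrow>\<^sub>E downsets X r"
    and mono: "\<And>y y'. (y, y') \<in> s \<Longrightarrow> f y \<subseteq> f y'"
    using s_props(4) unfolding isotone_downset_maps_def monotone_on_def by auto blast+
  have down: "f y \<subseteq> X" "(x, x') \<in> r \<Longrightarrow> x' \<in> f y \<Longrightarrow> x \<in> f y" if "y \<in> Y" for x x' y
    using PiE_mem [OF f that] by (auto simp: downsets_def)
  let ?R = "{(x, y). y \<in> Y \<and> x \<in> f y}"
  have "?R \<in> carrier (stable_relations X r Y s)"
    unfolding stable_relations_iff using down mono s_props(4) by blast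
  moreover have "(\<lambda>y\<in>Y. ?R\<inverse> `` {y}) = f"
  proof (rule extensionalityI [of _ Y])
    show "f \<in> extensional Y" using f by (simp add: PiE_def)
  qed auto
  ultimately show "\<exists>R\<in>carrier (stable_relations X r Y s). (\<lambda>y\<in>Y. R\<inverse> `` {y}) = f"
    by blast
qed (rule partial_order_stable_relations partial_order_isotone_downset_maps)+

text \<open>Rows replace columns and the closure conditions exchange roles: \<open>s\<close> makes
  each row an upset, \<open>r\<close> makes the rows shrink as \<open>x\<close> grows.\<close>

lemma stable_iso_antitone_upset_maps:
  "order_isomorphic (stable_relations X r Y s) (antitone_upset_maps X r Y s)"
proof (rule order_isomorphicI [where f = "\<lambda>R. \<lambda>x\<in>X. R `` {x}"])
  fix R assume R: "R \<in> carrier (stable_relations X r Y s)"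
  then show "(\<lambda>x\<in>X. R `` {x}) \<in> carrier (antitone_upset_maps X r Y s)"
    unfolding stable_relations_iff antitone_upset_maps_def
    by (auto simp: upsets_def monotone_on_def)
next
  fix R R' assume "R \<in> carrier (stable_relations X r Y s)"
    "R' \<in> carrier (stable_relations X r Y s)"
  then have "(\<forall>x\<in>X. R `` {x} \<subseteq> R' `` {x}) \<longleftrightarrow> R \<subseteq> R'"
    unfolding stable_relations_iff by blast
  then show "(\<lambda>x\<in>X. R `` {x}) \<sqsubseteq>\<^bsub>antitone_upset_maps X r Y s\<^esub> (\<lambda>x\<in>X. R' `` {x}) \<longleftrightarrow>
      R \<sqsubseteq>\<^bsub>stable_relations X r Y s\<^esub> R'"
    by (simp add: antitone_upset_maps_def stable_relations_def)
next
  fix g assume "g \<in> carrier (antitone_upset_maps X r Y s)"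
  then have g: "g \<in> X \<rightarrow>\<^sub>E upsets Y s"
    and mono: "\<And>x x'. (x, x') \<in> r \<Longrightarrow> g x' \<subseteq> g x"
    using r_props(4) unfolding antitone_upset_maps_def monotone_on_def by auto blast+
  have up: "g x \<subseteq> Y" "(y, y') \<in> s \<Longrightarrow> y \<in> g x \<Longrightarrow> y' \<in> g x" if "x \<in> X" for x y y'
    using PiE_mem [OF g that] by (auto simp: upsets_def)
  let ?R = "{(x, y). x \<in> X \<and> y \<in> g x}"
  have "?R \<in> carrier (stable_relations X r Y s)"
    unfolding stable_relations_iff using up mono r_props(4) by blast
  moreover have "(\<lambda>x\<in>X. ?R `` {x}) = g"
  proof (rule extensionalityI [of _ X])
    show "g \<in> extensional X" using g by (simp add: PiE_def)
  qed auto
  ultimately show "\<exists>R\<in>carrier (stable_relations X r Y s). (\<lambda>x\<in>X. R `` {x}) = g"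
    by blast
qed (rule partial_order_stable_relations partial_order_antitone_upset_maps)+

lemma stable_iso_union_preserving_maps:
  "order_isomorphic (stable_relations X r Y s) (union_preserving_maps X r Y s)"
proof (rule order_isomorphicI [where f = "\<lambda>R. \<lambda>D\<in>downsets Y s. R\<inverse> `` D"])
  interpret D: complete_ring_of_sets "incl_order (downsets Y s)" "\<lambda>D. D" Y
    by (rule complete_ring_of_sets_downsets [OF s_props(4)])
  have Un: "\<Union>\<A> \<in> downsets Y s" if "\<A> \<subseteq> downsets Y s" for \<A>
    using D.Union_exists [of \<A>] that by simp
  {
    fix R assume R: "R \<in> carrier (stable_relations X r Y s)"
    have "R\<inverse> `` D \<in> downsets X r" for D
      using R unfolding stable_relations_iff downsets_def by blast
    moreover have "(\<lambda>D\<in>downsets Y s. R\<inverse> `` D) (\<Union>\<A>) = \<Union>((\<lambda>D\<in>downsets Y s. R\<inverse> `` D) ` \<A>)"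
      if "\<A> \<subseteq> downsets Y s" for \<A>
      using Un [OF that] that by (auto simp: subset_iff)
    ultimately show "(\<lambda>D\<in>downsets Y s. R\<inverse> `` D) \<in> carrier (union_preserving_maps X r Y s)"
      by (simp add: union_preserving_maps_def)
  next
    fix R R' assume R: "R \<in> carrier (stable_relations X r Y s)"
      and R': "R' \<in> carrier (stable_relations X r Y s)"
    have "(\<forall>D\<in>downsets Y s. R\<inverse> `` D \<subseteq> R'\<inverse> `` D) \<longleftrightarrow> R \<subseteq> R'"
    proof
      assume le: "\<forall>D\<in>downsets Y s. R\<inverse> `` D \<subseteq> R'\<inverse> `` D"
      show "R \<subseteq> R'"
      proof (rule subrelI)
        fix x y assume "(x, y) \<in> R"
        moreover from this have "(y, y) \<in> s"
          using R s_props(1) unfolding stable_relations_iff refl_on_def by blast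
        \<comment> \<open>Testing at the principal downset of \<open>y\<close> is enough: it yields
          a pair of \<open>R'\<close> from \<open>x\<close> to some element below \<open>y\<close>,
          and stability of \<open>R'\<close> moves that element up to \<open>y\<close>.\<close>
        ultimately have "x \<in> R\<inverse> `` (s\<inverse> `` {y})"
          by blast
        then have "x \<in> R'\<inverse> `` (s\<inverse> `` {y})"
          using bspec [OF le principal_downset [OF s]] by (rule rev_subsetD)
        then show "(x, y) \<in> R'"
          using R' unfolding stable_relations_iff by blast
      qed
    qed blast
    then show "(\<lambda>D\<in>downsets Y s. R\<inverse> `` D) \<sqsubseteq>\<^bsub>union_preserving_maps X r Y s\<^esub>
        (\<lambda>D\<in>downsets Y s. R'\<inverse> `` D) \<longleftrightarrow> R \<sqsubseteq>\<^bsub>stable_relations X r Y s\<^esub> R'"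
      by (simp add: union_preserving_maps_def stable_relations_def)
  next
    fix h assume "h \<in> carrier (union_preserving_maps X r Y s)"
    then have h: "h \<in> downsets Y s \<rightarrow>\<^sub>E downsets X r"
      and pres: "\<And>\<A>. \<A> \<subseteq> downsets Y s \<Longrightarrow> h (\<Union>\<A>) = \<Union>(h ` \<A>)"
      by (auto simp: union_preserving_maps_def)
    \<comment> \<open>A stable relation sends the principal downset of \<open>y\<close> to its
      column at \<open>y\<close>, so the preimage of \<open>h\<close> must have these
      columns.\<close>
    let ?R = "{(x, y). y \<in> Y \<and> x \<in> h (s\<inverse> `` {y})}"
    have principal: "h D = (\<Union>y\<in>D. h (s\<inverse> `` {y}))" if "D \<in> downsets Y s" for D
    proof -
      have "h D = h (\<Union>((\<lambda>y. s\<inverse> `` {y}) ` D))"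
        using downset_eq_Union_principal [OF s that] by simp
      also have "\<dots> = (\<Union>y\<in>D. h (s\<inverse> `` {y}))"
        using pres [of "(\<lambda>y. s\<inverse> `` {y}) ` D"] principal_downset [OF s]
        by (simp add: image_subset_iff image_image)
      finally show ?thesis .
    qed
    \<comment> \<open>Monotonicity follows from union preservation: \<open>y\<close> is one of the
      indices when the principal downset of \<open>y'\<close> is decomposed.\<close>
    have "h (s\<inverse> `` {y}) \<subseteq> h (s\<inverse> `` {y'})" if "(y, y') \<in> s" for y y'
      using principal [OF principal_downset [OF s], of y'] that by blast
    moreover have "h (s\<inverse> `` {y}) \<in> downsets X r" for y
      using PiE_mem [OF h principal_downset [OF s]] .
    ultimately have "?R \<in> carrier (stable_relations X r Y s)"
      unfolding stable_relations_iff downsets_def using s_props(4) by blast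
    moreover have "(\<lambda>D\<in>downsets Y s. ?R\<inverse> `` D) = h"
    proof (rule extensionalityI [of _ "downsets Y s"])
      show "h \<in> extensional (downsets Y s)" using h by (simp add: PiE_def)
      fix D assume D: "D \<in> downsets Y s"
      then have "D \<subseteq> Y" by (simp add: downsets_def)
      then show "(\<lambda>D\<in>downsets Y s. ?R\<inverse> `` D) D = h D"
        using D principal [OF D] by auto
    qed auto
    ultimately show "\<exists>R\<in>carrier (stable_relations X r Y s). (\<lambda>D\<in>downsets Y s. R\<inverse> `` D) = h"
      by blast
  }
qed (rule partial_order_stable_relations partial_order_union_preserving_maps)+

lemma upset_downset_tensor_eq:
  "upset_downset_tensor X r Y s = pointwise_order (upsets X r) (\<supseteq>)
    {f \<in> upsets X r \<rightarrow>\<^sub>E downsets Y s. \<forall>\<A>\<subseteq>upsets X r. f (\<Union>\<A>) = Y \<inter> \<Inter>(f ` \<A>)}"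
proof -
  have "{f \<in> upsets X r \<rightarrow>\<^sub>E downsets Y s.
        sup_pres (incl_order (upsets X r)) (inv_gorder (incl_order (downsets Y s))) f}
      = {f \<in> upsets X r \<rightarrow>\<^sub>E downsets Y s. \<forall>\<A>\<subseteq>upsets X r. f (\<Union>\<A>) = Y \<inter> \<Inter>(f ` \<A>)}"
    using sup_pres_upsets_downsets_iff [OF r_props(4) s_props(4)]
    by (intro Collect_cong conj_cong refl) (auto simp: PiE_def)
  then show ?thesis
    by (simp add: upset_downset_tensor_def tensor_product_def)
qed

text \<open>The image of any set under a stable relation is an upset of \<open>Y\<close>, so its
  complement is a downset, and complementing turns unions into intersections. The complement
  reverses inclusion and so does the order of the tensor product, so the map is isotone.\<close>

lemma stable_iso_upset_downset_tensor:
  "order_isomorphic (stable_relations X r Y s) (upset_downset_tensor X r Y s)"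
proof (rule order_isomorphicI [where f = "\<lambda>R. \<lambda>U\<in>upsets X r. Y - R `` U"])
  interpret U: complete_ring_of_sets "incl_order (upsets X r)" "\<lambda>U. U" X
    by (rule complete_ring_of_sets_upsets [OF r_props(4)])
  have Un: "\<Union>\<A> \<in> upsets X r" if "\<A> \<subseteq> upsets X r" for \<A>
    using U.Union_exists [of \<A>] that by simp
  {
    fix R assume R: "R \<in> carrier (stable_relations X r Y s)"
    have "Y - R `` U \<in> downsets Y s" for U
      using R s_props(4) unfolding stable_relations_iff downsets_def by blast
    moreover have "(\<lambda>U\<in>upsets X r. Y - R `` U) (\<Union>\<A>)
        = Y \<inter> \<Inter>((\<lambda>U\<in>upsets X r. Y - R `` U) ` \<A>)" if "\<A> \<subseteq> upsets X r" for \<A>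
      using Un [OF that] that by (auto simp: subset_iff)
    ultimately show "(\<lambda>U\<in>upsets X r. Y - R `` U) \<in> carrier (upset_downset_tensor X r Y s)"
      by (simp add: upset_downset_tensor_eq)
  next
    fix R R' assume R: "R \<in> carrier (stable_relations X r Y s)"
      and R': "R' \<in> carrier (stable_relations X r Y s)"
    have "(\<forall>U\<in>upsets X r. Y - R' `` U \<subseteq> Y - R `` U) \<longleftrightarrow> R \<subseteq> R'"
    proof
      assume le: "\<forall>U\<in>upsets X r. Y - R' `` U \<subseteq> Y - R `` U"
      show "R \<subseteq> R'"
      proof (rule subrelI)
        fix x y assume xy: "(x, y) \<in> R"
        then have "(x, x) \<in> r" "y \<in> Y"
          using R r_props(1) unfolding stable_relations_iff refl_on_def by blast+
        \<comment> \<open>Here the test set is the principal upset of \<open>x\<close>; stability of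
          \<open>R'\<close> then brings the element found above \<open>x\<close> back down to
          \<open>x\<close>.\<close>
        with xy have "y \<in> R' `` (r `` {x})"
          using le principal_upset [OF r, of x] by blast
        then show "(x, y) \<in> R'"
          using R' unfolding stable_relations_iff by blast
      qed
    qed blast
    then show "(\<lambda>U\<in>upsets X r. Y - R `` U) \<sqsubseteq>\<^bsub>upset_downset_tensor X r Y s\<^esub>
        (\<lambda>U\<in>upsets X r. Y - R' `` U) \<longleftrightarrow> R \<sqsubseteq>\<^bsub>stable_relations X r Y s\<^esub> R'"
      by (simp add: upset_downset_tensor_eq stable_relations_def)
  next
    fix f assume "f \<in> carrier (upset_downset_tensor X r Y s)"
    then have f: "f \<in> upsets X r \<rightarrow>\<^sub>E downsets Y s"
      and pres: "\<And>\<A>. \<A> \<subseteq> upsets X r \<Longrightarrow> f (\<Union>\<A>) = Y \<inter> \<Inter>(f ` \<A>)"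
      by (auto simp: upset_downset_tensor_eq)
    \<comment> \<open>For a stable \<open>R\<close> the image of the principal upset of
      \<open>x\<close> is the row at \<open>x\<close>, so this row has to be the complement of the
      value of \<open>f\<close> there.\<close>
    let ?R = "{(x, y). x \<in> X \<and> y \<in> Y - f (r `` {x})}"
    have principal: "f U = Y \<inter> (\<Inter>x\<in>U. f (r `` {x}))" if "U \<in> upsets X r" for U
    proof -
      have "f U = f (\<Union>((\<lambda>x. r `` {x}) ` U))"
        using upset_eq_Union_principal [OF r that] by simp
      also have "\<dots> = Y \<inter> (\<Inter>x\<in>U. f (r `` {x}))"
        using pres [of "(\<lambda>x. r `` {x}) ` U"] principal_upset [OF r]
        by (simp add: image_subset_iff image_image)
      finally show ?thesis .
    qed
    \<comment> \<open>The value at the principal upset of \<open>x\<close> is an intersection in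
      which \<open>x'\<close> is one of the indices. After complementation this is closure of the
      relation under \<open>r\<close>.\<close>
    have "f (r `` {x}) \<subseteq> f (r `` {x'})" if "(x, x') \<in> r" for x x'
      using principal [OF principal_upset [OF r], of x] that by blast
    moreover have "f (r `` {x}) \<in> downsets Y s" for x
      using PiE_mem [OF f principal_upset [OF r]] .
    ultimately have "?R \<in> carrier (stable_relations X r Y s)"
      unfolding stable_relations_iff downsets_def using r_props(4) s_props(4) by blast
    moreover have "(\<lambda>U\<in>upsets X r. Y - ?R `` U) = f"
    proof (rule extensionalityI [of _ "upsets X r"])
      show "f \<in> extensional (upsets X r)" using f by (simp add: PiE_def)
      fix U assume U: "U \<in> upsets X r"
      then have "U \<subseteq> X" by (simp add: upsets_def)
      then show "(\<lambda>U\<in>upsets X r. Y - ?R `` U) U = f U"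
        using U principal [OF U] by auto
    qed auto
    ultimately show "\<exists>R\<in>carrier (stable_relations X r Y s).
        (\<lambda>U\<in>upsets X r. Y - R `` U) = f"
      by blast
  }
qed (rule partial_order_stable_relations partial_order_upset_downset_tensor)+

lemma superalgebraic_if_iso_stable:
  assumes "partial_order M" and "order_isomorphic (stable_relations X r Y s) M"
  shows "superalgebraic_lattice M"
  using complete_ring_of_sets_transfer [OF complete_ring_of_sets_stable_relations assms(1)]
    order_isomorphic_sym [OF assms(2)] r_props(4) s_props(4) complete_ring_of_sets.superalgebraic
  by blast

end

theorem theorem2p1:
  fixes X Y :: "'a set" and r s :: "'a rel"
  assumes "partial_order_on X r"
    and "partial_order_on Y s"
    and "X \<inter> Y = {}"
  shows "superalgebraic_lattice (quasiorder_extensions X r Y s) \<and>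
    superalgebraic_lattice (isotone_downset_maps X r Y s) \<and>
    superalgebraic_lattice (antitone_upset_maps X r Y s) \<and>
    superalgebraic_lattice (union_preserving_maps X r Y s) \<and>
    superalgebraic_lattice (stable_relations X r Y s) \<and>
    superalgebraic_lattice (upset_downset_tensor X r Y s) \<and>
    order_isomorphic (quasiorder_extensions X r Y s) (isotone_downset_maps X r Y s) \<and>
    order_isomorphic (quasiorder_extensions X r Y s) (antitone_upset_maps X r Y s) \<and>
    order_isomorphic (quasiorder_extensions X r Y s) (union_preserving_maps X r Y s) \<and>
    order_isomorphic (quasiorder_extensions X r Y s) (stable_relations X r Y s) \<and>
    order_isomorphic (quasiorder_extensions X r Y s) (upset_downset_tensor X r Y s) \<and>
    order_isomorphic (isotone_downset_maps X r Y s) (antitone_upset_maps X r Y s) \<and>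
    order_isomorphic (isotone_downset_maps X r Y s) (union_preserving_maps X r Y s) \<and>
    order_isomorphic (isotone_downset_maps X r Y s) (stable_relations X r Y s) \<and>
    order_isomorphic (isotone_downset_maps X r Y s) (upset_downset_tensor X r Y s) \<and>
    order_isomorphic (antitone_upset_maps X r Y s) (union_preserving_maps X r Y s) \<and>
    order_isomorphic (antitone_upset_maps X r Y s) (stable_relations X r Y s) \<and>
    order_isomorphic (antitone_upset_maps X r Y s) (upset_downset_tensor X r Y s) \<and>
    order_isomorphic (union_preserving_maps X r Y s) (stable_relations X r Y s) \<and>
    order_isomorphic (union_preserving_maps X r Y s) (upset_downset_tensor X r Y s) \<and>
    order_isomorphic (stable_relations X r Y s) (upset_downset_tensor X r Y s)"
proof -
  interpret disjoint_orders X Y r s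
    by (rule disjoint_orders.intro [OF assms])
  note isos = stable_iso_quasiorder_extensions stable_iso_isotone_downset_maps
    stable_iso_antitone_upset_maps stable_iso_union_preserving_maps
    stable_iso_upset_downset_tensor
  note isos' = isos [THEN order_isomorphic_sym]
  \<comment> \<open>The five pairs containing the stable relations are direct or reversed
    isomorphisms; the other ten are composed through the stable relations.\<close>
  show ?thesis
    by (intro conjI superalgebraic_if_iso_stable [OF _ isos(1)]
      superalgebraic_if_iso_stable [OF _ isos(2)] superalgebraic_if_iso_stable [OF _ isos(3)]
      superalgebraic_if_iso_stable [OF _ isos(4)] superalgebraic_if_iso_stable [OF _ isos(5)]
      complete_ring_of_sets.superalgebraic [OF complete_ring_of_sets_stable_relations]
      isos isos'
      isos'(1) [THEN order_isomorphic_trans, OF isos(2)]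
      isos'(1) [THEN order_isomorphic_trans, OF isos(3)]
      isos'(1) [THEN order_isomorphic_trans, OF isos(4)]
      isos'(1) [THEN order_isomorphic_trans, OF isos(5)]
      isos'(2) [THEN order_isomorphic_trans, OF isos(3)]
      isos'(2) [THEN order_isomorphic_trans, OF isos(4)]
      isos'(2) [THEN order_isomorphic_trans, OF isos(5)]
      isos'(3) [THEN order_isomorphic_trans, OF isos(4)]
      isos'(3) [THEN order_isomorphic_trans, OF isos(5)]
      isos'(4) [THEN order_isomorphic_trans, OF isos(5)]
      r_props(4) s_props(4)
      partial_order_quasiorder_extensions partial_order_isotone_downset_maps
      partial_order_antitone_upset_maps partial_order_union_preserving_maps
      partial_order_upset_downset_tensor)
qed

end
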